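(* Let $0<\epsilon<1$, let $b$ be a positive integer and let $0<\alpha<\epsilon/4$. Let $B=\{0,1/b,2/b,\dots,1\}$. Let $m$ be a positive integer, let $S\subseteq B^m$, and set $d=\mathrm{fatV}_S(\epsilon/2-\alpha)$. If $d\ge 1$, then $$\mathcal M(\epsilon,S)\ \le\ \frac{\epsilon}{2\alpha}\,(b+1)^{4d/\alpha}.$$
   Context: For $v,w\in\mathbb R^m$, $\ell_1(v,w)=\frac1m\sum_{i=1}^m|v_i-w_i|$ (normalized). For $S\subseteq\mathbb R^m$, the packing number $\mathcal M(\epsilon,S)$ is the size of the largest subset $T$ of $S$ such that any two distinct elements $v,w$ of $T$ satisfy $\ell_1(v,w)>\epsilon$. For $r\in[0,1]$, $\gamma>0$, define $\psi_{r,\gamma}:[0,1]\to\{0,\star,1\}$ by $\psi_{r,\gamma}(y)=1$ if $y\ge r+\gamma$, $\psi_{r,\gamma}(y)=0$ if $y\le r-\gamma$, and $\psi_{r,\gamma}(y)=\star$ if $|y-r|<\gamma$. For a set $F$ of functions from a set $X$ to $[0,1]$, a sequence $x_1,\dots,x_d\in X$ is $\gamma$-fatly Vapnik-shattered by $F$ if there is a single $r\in[0,1]$ with $\{0,1\}^d\subseteq\{(\psi_{r,\gamma}(f(x_1)),\dots,\psi_{r,\gamma}(f(x_d))):f\in F\}$. $\mathrm{fatV}_F(\gamma)$ is the largest length of such a sequence ($0$ if no point is shattered). A vector $v\in[0,1]^m$ is identified with the function $i\mapsto v_i$ on $\{1,\dots,m\}$, and for $S\subseteq[0,1]^m$, $\mathrm{fatV}_S(\gamma)$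 is the dimension of the corresponding class of functions on $\{1,\dots,m\}$. *)

theory Defs
  imports Complex_Main "HOL-Library.FuncSet" "HOL-Library.Extended_Nat" "HOL-Library.Extended_Real"
begin

text \<open>
  A vector in \<open>A\<^sup>m\<close> is an element of \<open>{1..m} \<rightarrow>\<^sub>E A\<close>, i.e. a function on the indices \<open>1, \<dots>, m\<close>
  that is \<open>undefined\<close> elsewhere, so that equality of vectors is equality of functions.
\<close>

definition l1_dist :: "nat \<Rightarrow> (nat \<Rightarrow> real) \<Rightarrow> (nat \<Rightarrow> real) \<Rightarrow> real" where
  "l1_dist m v w = (1 / real m) * (\<Sum>i=1..m. \<bar>v i - w i\<bar>)"

text \<open>
  The supremum is \<open>\<infinity>\<close> if there are arbitrarily large separated subsets; it is attained otherwise,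
  in particular for every finite \<open>S\<close>.
\<close>

definition packing_number :: "nat \<Rightarrow> real \<Rightarrow> (nat \<Rightarrow> real) set \<Rightarrow> enat" where
  "packing_number m \<epsilon> S =
     (SUP T \<in> {T. T \<subseteq> S \<and> finite T \<and> (\<forall>v\<in>T. \<forall>w\<in>T. v \<noteq> w \<longrightarrow> l1_dist m v w > \<epsilon>)}. enat (card T))"

datatype tri = Zero | Star | One

text \<open>For \<open>\<gamma> > 0\<close> the last case is exactly \<open>\<bar>y - r\<bar> < \<gamma>\<close>.\<close>

definition psi :: "real \<Rightarrow> real \<Rightarrow> real \<Rightarrow> tri" where
  "psi r \<gamma> y = (if y \<ge> r + \<gamma> then One else if y \<le> r - \<gamma> then Zero else Star)"

definition fatly_V_shattered :: "('a \<Rightarrow> real) set \<Rightarrow> real \<Rightarrow> 'a list \<Rightarrow> bool" where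
  "fatly_V_shattered F \<gamma> xs \<longleftrightarrow>
     (\<exists>r\<in>{0..1}. {p. length p = length xs \<and> set p \<subseteq> {Zero, One}}
                   \<subseteq> {map (\<lambda>x. psi r \<gamma> (f x)) xs | f. f \<in> F})"

text \<open>
  The functions in \<open>F\<close> have domain \<open>X\<close>. The empty sequence contributes only the length \<open>0\<close>, and
  \<open>Sup {} = 0\<close>, so the value is \<open>0\<close> if no point is shattered.
\<close>

definition fatV :: "'a set \<Rightarrow> ('a \<Rightarrow> real) set \<Rightarrow> real \<Rightarrow> enat" where
  "fatV X F \<gamma> = (SUP xs \<in> {xs. set xs \<subseteq> X \<and> fatly_V_shattered F \<gamma> xs}. enat (length xs))"

lemma fatly_V_shattered_distinct:
  assumes "fatly_V_shattered F \<gamma> xs"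
  shows "distinct xs"
proof (rule ccontr)
  assume "\<not> distinct xs"
  then obtain i j where ij: "i < length xs" "j < length xs" "i \<noteq> j" "xs ! i = xs ! j"
    by (auto simp: distinct_conv_nth)
  obtain r where r: "{p. length p = length xs \<and> set p \<subseteq> {Zero, One}}
                   \<subseteq> {map (\<lambda>x. psi r \<gamma> (f x)) xs | f. f \<in> F}"
    using assms by (auto simp: fatly_V_shattered_def)
  define p where "p = (replicate (length xs) Zero)[i := One]"
  have "p \<in> {p. length p = length xs \<and> set p \<subseteq> {Zero, One}}"
    using set_update_subset_insert[of "replicate (length xs) Zero" i One]
    by (auto simp: p_def set_replicate_conv_if split: if_splits)
  then obtain f where f: "p = map (\<lambda>x. psi r \<gamma> (f x)) xs"
    using r by blast
  have "p ! i = p ! j"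
    using ij by (simp add: f)
  then show False
    using ij by (simp add: p_def)
qed

text \<open>On a finite domain the dimension is therefore always finite.\<close>

lemma fatV_le_card:
  assumes "finite X"
  shows "fatV X F \<gamma> \<le> enat (card X)"
  unfolding fatV_def
proof (rule SUP_least)
  fix xs assume "xs \<in> {xs. set xs \<subseteq> X \<and> fatly_V_shattered F \<gamma> xs}"
  then show "enat (length xs) \<le> enat (card X)"
    using fatly_V_shattered_distinct[of F \<gamma> xs] card_mono[OF assms, of "set xs"]
    by (simp add: distinct_card)
qed

end

theory Submission
  imports Defs
begin

text \<open>
  Fix a threshold \<open>r\<close> and a sample. The points where a function is not \<open>\<star>\<close> carry a set family of
  VC dimension at most \<open>d\<close>, whose one-inclusion graph has at most \<open>d\<close> edges per vertex, so some
  leave-one-out predictor errs on at most \<open>2 d\<close> of these points for every function in the class.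
  Averaging over thresholds gives a leave-one-out predictor of real values whose total error on
  \<open>n + 1\<close> points is at most \<open>(n + 1) (\<gamma> + 1 / N) + 2 d\<close>, where the
  thresholds are \<open>j / N\<close>. Averaging over samples from \<open>{1..m}\<close> fixes \<open>n\<close> points from whose labels
  the elements of a separated set \<open>T\<close> are predicted with \<open>\<ell>\<^sub>1\<close> error at most
  \<open>\<gamma> + 1 / N + 2 d / (n + 1)\<close> on average over \<open>T\<close>. Elements predicted within \<open>\<epsilon> / 2\<close> are determined
  by their labels, so there are at most \<open>(b + 1)\<^sup>n\<close> of them, and Markov's inequality bounds the
  number of the others. With \<open>\<gamma> = \<epsilon> / 2 - \<alpha>\<close>, \<open>n = \<lfloor>4 d / \<alpha>\<rfloor> - 2\<close> and \<open>N = 2 (n + 1)\<close> the resulting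
  bound is \<open>4 \<epsilon> / (2 \<alpha>) (b + 1)\<^sup>n\<close>, and the factor \<open>4\<close> is absorbed by \<open>(b + 1)\<^sup>2\<close>.
\<close>

section \<open>The one-inclusion graph: edge density and leave-one-out prediction\<close>

definition shatters :: "'a set set \<Rightarrow> 'a set \<Rightarrow> bool" where
  "shatters F W \<longleftrightarrow> Pow W \<subseteq> (\<lambda>A. A \<inter> W) ` F"

text \<open>Each undirected edge is stored once, as its lower endpoint together with the element
  added, so the cardinality counts edges without a factor 2.\<close>

definition inclusion_edges :: "'a set set \<Rightarrow> ('a set \<times> 'a) set" where
  "inclusion_edges F = {(A, x). A \<in> F \<and> x \<notin> A \<and> insert x A \<in> F}"

lemma shatters_mono: "shatters F W \<Longrightarrow> F \<subseteq> G \<Longrightarrow> shatters G W"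
  unfolding shatters_def by blast

lemma finite_inclusion_edges:
  assumes "finite X" "F \<subseteq> Pow X"
  shows "finite (inclusion_edges F)"
proof (rule finite_subset)
  show "inclusion_edges F \<subseteq> Pow X \<times> X"
    using assms(2) by (auto simp: inclusion_edges_def)
  show "finite (Pow X \<times> X)"
    using assms(1) by simp
qed

text \<open>Induction on the ground set, splitting off a point \<open>a\<close>. Edges in direction
  \<open>a\<close> correspond to \<open>F0 \<inter> F1\<close>; all others come from
  \<open>F0\<close> or \<open>F1\<close>. The union of these two families still has dimension at
  most \<open>d\<close>, while their intersection loses one dimension, and this gain pays for the
  edges in direction \<open>a\<close>.\<close>

lemma card_inclusion_edges_le:
  assumes "finite X" "F \<subseteq> Pow X" "\<And>W. shatters F W \<Longrightarrow> card W \<le> d"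
  shows "card (inclusion_edges F) \<le> d * card F"
  using assms
proof (induction X arbitrary: F d rule: finite_induct)
  case empty
  then have "inclusion_edges F = {}"
    by (auto simp: inclusion_edges_def)
  then show ?case
    by simp
next
  case (insert a X)
  define F0 where "F0 = {A \<in> F. a \<notin> A}"
  define F1 where "F1 = {A. a \<notin> A \<and> insert a A \<in> F}"
  have sub: "F0 \<subseteq> Pow X" "F1 \<subseteq> Pow X"
    using insert.prems(1) by (auto simp: F0_def F1_def)
  then have fin: "finite F0" "finite F1"
    using insert.hyps(1) by (meson finite_Pow_iff finite_subset)+
  have finE: "finite (inclusion_edges G)" if "G \<subseteq> Pow X" for G
    using finite_inclusion_edges[OF insert.hyps(1) that] .
  have inj: "inj_on (insert a) F1"
    by (auto simp: inj_on_def F1_def)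
  have F_eq: "F = F0 \<union> insert a ` F1"
  proof
    show "F \<subseteq> F0 \<union> insert a ` F1"
    proof
      fix A assume "A \<in> F"
      then show "A \<in> F0 \<union> insert a ` F1"
        using image_eqI[of A "insert a" "A - {a}" F1]
        by (cases "a \<in> A") (auto simp: F0_def F1_def insert_absorb)
    qed
  qed (auto simp: F0_def F1_def)
  have card_F: "card F = card F0 + card F1"
  proof -
    have "card F = card F0 + card (insert a ` F1)"
      unfolding F_eq by (rule card_Un_disjoint) (use fin in \<open>auto simp: F0_def\<close>)
    then show ?thesis
      using card_image[OF inj] by simp
  qed

  \<comment> \<open>\<open>up\<close> lifts an edge of \<open>F1\<close> to the edge of
    \<open>F\<close> whose endpoints both contain \<open>a\<close>.\<close>
  define up where "up = (\<lambda>p::'a set \<times> 'a. (insert a (fst p), snd p))"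
  have edges_eq: "inclusion_edges F =
      inclusion_edges F0 \<union> up ` inclusion_edges F1 \<union> (\<lambda>A. (A, a)) ` (F0 \<inter> F1)"
    (is "?L = ?R")
  proof
    show "?L \<subseteq> ?R"
    proof clarify
      fix A x assume Ax: "(A, x) \<in> inclusion_edges F"
        and no: "(A, x) \<notin> (\<lambda>A. (A, a)) ` (F0 \<inter> F1)" "(A, x) \<notin> up ` inclusion_edges F1"
      have "x \<noteq> a"
        using Ax no by (auto simp: inclusion_edges_def F0_def F1_def)
      have "a \<notin> A"
      proof
        assume "a \<in> A"
        then have "(A - {a}, x) \<in> inclusion_edges F1" "up (A - {a}, x) = (A, x)"
          using Ax \<open>x \<noteq> a\<close>
          by (auto simp: inclusion_edges_def F1_def up_def insert_absorb insert_commute)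
        then show False
          using no by (metis image_eqI)
      qed
      then show "(A, x) \<in> inclusion_edges F0"
        using Ax \<open>x \<noteq> a\<close> by (auto simp: inclusion_edges_def F0_def)
    qed
    show "?R \<subseteq> ?L"
      by (auto simp: inclusion_edges_def F0_def F1_def up_def insert_commute)
  qed
  have e: "card (inclusion_edges F) \<le>
      card (inclusion_edges F0) + card (inclusion_edges F1) + card (F0 \<inter> F1)"
    unfolding edges_eq
    by (intro order.trans[OF card_Un_le] add_mono card_image_le)
       (use fin finE[OF sub(2)] in auto)
  \<comment> \<open>Regrouping by union and intersection makes the dimension bounds applicable;
    \<open>F0 \<union> F1\<close> may have further edges, which only helps.\<close>
  have e01: "card (inclusion_edges F0) + card (inclusion_edges F1) =
      card (inclusion_edges F0 \<union> inclusion_edges F1) +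
      card (inclusion_edges F0 \<inter> inclusion_edges F1)"
    by (rule card_Un_Int) (use finE sub in auto)
  have eU: "card (inclusion_edges F0 \<union> inclusion_edges F1) \<le> card (inclusion_edges (F0 \<union> F1))"
    using finE[of "F0 \<union> F1"] sub by (intro card_mono) (auto simp: inclusion_edges_def)
  have eI: "inclusion_edges F0 \<inter> inclusion_edges F1 = inclusion_edges (F0 \<inter> F1)"
    by (auto simp: inclusion_edges_def)
  have U: "card (inclusion_edges (F0 \<union> F1)) \<le> d * card (F0 \<union> F1)"
  proof (rule insert.IH)
    show "F0 \<union> F1 \<subseteq> Pow X"
      using sub by auto
    fix W assume W: "shatters (F0 \<union> F1) W"
    then have "a \<notin> W"
      by (auto simp: shatters_def F0_def F1_def)
    have "shatters F W"
      unfolding shatters_def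
    proof
      fix V assume "V \<in> Pow W"
      then obtain A where A: "A \<in> F0 \<union> F1" "V = A \<inter> W"
        using W by (auto simp: shatters_def)
      then have "A \<in> F \<or> insert a A \<in> F" "V = insert a A \<inter> W"
        using \<open>a \<notin> W\<close> by (auto simp: F0_def F1_def)
      then show "V \<in> (\<lambda>A. A \<inter> W) ` F"
        using A(2) by blast
    qed
    then show "card W \<le> d"
      by (rule insert.prems(2))
  qed
  have Int: "card (inclusion_edges (F0 \<inter> F1)) + card (F0 \<inter> F1) \<le> d * card (F0 \<inter> F1)"
  proof -
    \<comment> \<open>Every trace on \<open>W\<close> is realised in \<open>F\<close> both with and
      without \<open>a\<close>, so \<open>F\<close> shatters \<open>insert a W\<close>.\<close>
    have W: "Suc (card W) \<le> d" if sh: "shatters (F0 \<inter> F1) W" for W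
    proof -
      have "W \<in> (\<lambda>A. A \<inter> W) ` (F0 \<inter> F1)"
        using sh by (auto simp: shatters_def)
      then have "W \<subseteq> X" "a \<notin> W"
        using sub by (auto simp: F0_def)
      have "shatters F (insert a W)"
        unfolding shatters_def
      proof
        fix V assume "V \<in> Pow (insert a W)"
        then have "V - {a} \<in> Pow W"
          by auto
        then have "V - {a} \<in> (\<lambda>A. A \<inter> W) ` (F0 \<inter> F1)"
          using sh unfolding shatters_def by (rule subsetD[rotated])
        then obtain A where A: "V - {a} = A \<inter> W" "A \<in> F0 \<inter> F1"
          by (rule imageE)
        have "a \<notin> A"
          using A(2) by (simp add: F0_def)
        show "V \<in> (\<lambda>A. A \<inter> insert a W) ` F"
        proof (rule image_eqI)
          show "V = (if a \<in> V then insert a A else A) \<inter> insert a W"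
            using A(1) \<open>a \<notin> A\<close> \<open>a \<notin> W\<close> by auto
          show "(if a \<in> V then insert a A else A) \<in> F"
            using A(2) by (simp add: F0_def F1_def)
        qed
      qed
      then have "card (insert a W) \<le> d"
        by (rule insert.prems(2))
      then show ?thesis
        using \<open>a \<notin> W\<close> \<open>W \<subseteq> X\<close> insert.hyps(1) finite_subset by fastforce
    qed
    show ?thesis
    proof (cases "F0 \<inter> F1 = {}")
      case True
      then show ?thesis
        by (auto simp: inclusion_edges_def)
    next
      \<comment> \<open>A nonempty family shatters the empty set, so \<open>d\<close> is positive
        and the induction hypothesis can be used with \<open>d - 1\<close>.\<close>
      case False
      then have "shatters (F0 \<inter> F1) {}"
        by (auto simp: shatters_def)
      then obtain e where e: "d = Suc e"
        using W[of "{}"] by (cases d) auto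
      have "card (inclusion_edges (F0 \<inter> F1)) \<le> e * card (F0 \<inter> F1)"
        using sub W e by (intro insert.IH) auto
      then show ?thesis
        using e by simp
    qed
  qed
  have "d * card (F0 \<union> F1) + d * card (F0 \<inter> F1) = d * card F"
    using card_Un_Int[OF fin] card_F by (simp flip: distrib_left)
  then show ?case
    using e e01 eU U Int unfolding eI by linarith
qed

text \<open>Handshake count: \<open>U A\<close> collects the edges with lower endpoint
  \<open>A\<close>, \<open>D A\<close> those with upper endpoint \<open>A\<close>, so every edge
  occurs twice.\<close>

lemma sum_degree_eq:
  assumes "finite X" "F \<subseteq> Pow X"
  shows "(\<Sum>A\<in>F. card {x \<in> X. (if x \<in> A then A - {x} else insert x A) \<in> F}) =
    2 * card (inclusion_edges F)"
proof -
  have finF: "finite F"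
    using assms by (meson finite_Pow_iff finite_subset)
  define U where "U A = {x \<in> X. x \<notin> A \<and> insert x A \<in> F}" for A
  define D where "D A = {x \<in> X. x \<in> A \<and> A - {x} \<in> F}" for A
  have fin: "finite (U A)" "finite (D A)" for A
    using assms by (auto simp: U_def D_def)
  have "card {x \<in> X. (if x \<in> A then A - {x} else insert x A) \<in> F} = card (U A) + card (D A)" for A
  proof -
    have "{x \<in> X. (if x \<in> A then A - {x} else insert x A) \<in> F} = U A \<union> D A"
      by (auto simp: U_def D_def)
    moreover have "U A \<inter> D A = {}"
      by (auto simp: U_def D_def)
    ultimately show ?thesis
      using fin by (simp add: card_Un_disjoint)
  qed
  then have "(\<Sum>A\<in>F. card {x \<in> X. (if x \<in> A then A - {x} else insert x A) \<in> F}) =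
      (\<Sum>A\<in>F. card (U A)) + (\<Sum>A\<in>F. card (D A))"
    by (simp add: sum.distrib)
  also have "(\<Sum>A\<in>F. card (U A)) = card (Sigma F U)"
    using finF fin by (simp add: card_SigmaI)
  also have "Sigma F U = inclusion_edges F"
    using assms by (auto simp: U_def inclusion_edges_def)
  also have "(\<Sum>A\<in>F. card (D A)) = card (Sigma F D)"
    using finF fin by (simp add: card_SigmaI)
  also have "card (Sigma F D) = card (inclusion_edges F)"
    by (rule bij_betw_same_card[of "\<lambda>(A, x). (A - {x}, x)"],
        rule bij_betwI[where g = "\<lambda>(A, x). (insert x A, x)"])
       (use assms in \<open>auto simp: D_def inclusion_edges_def insert_absorb\<close>)
  finally show ?thesis
    by simp
qed

text \<open>The edges of the one-inclusion graph are oriented by repeatedly removing a vertex of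
  degree at most \<open>2 d\<close>: at each of its edges the prediction favours the other endpoint.\<close>

lemma one_inclusion_predictor:
  assumes "finite X" "F \<subseteq> Pow X" "\<And>W. shatters F W \<Longrightarrow> card W \<le> d"
  shows "\<exists>g. \<forall>A\<in>F. card {x \<in> X. g (A - {x}) x \<noteq> (x \<in> A)} \<le> 2 * d"
proof -
  have "finite F"
    using assms by (meson finite_Pow_iff finite_subset)
  then show ?thesis
    using assms(2,3)
  proof (induction F rule: finite_remove_induct)
    case empty
    then show ?case by simp
  next
    case (remove F)
    let ?flip = "\<lambda>x A. if x \<in> A then A - {x} else insert x A"
    \<comment> \<open>By the edge bound the average degree is at most \<open>2 * d\<close>, so some
      vertex has at most this degree.\<close>
    have "\<exists>A\<in>F. card {x \<in> X. ?flip x A \<in> F} \<le> 2 * d"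
    proof (rule ccontr)
      assume "\<not> ?thesis"
      then have "(\<Sum>A\<in>F. 2 * d) < (\<Sum>A\<in>F. card {x \<in> X. ?flip x A \<in> F})"
        using remove.hyps by (intro sum_strict_mono) (simp_all only: not_le bex_simps ball_simps, simp_all)
      then show False
        using card_inclusion_edges_le[OF assms(1) remove.prems]
          sum_degree_eq[OF assms(1) remove.prems(1)] by (simp add: mult.commute)
    qed
    then obtain A where A: "A \<in> F" "card {x \<in> X. ?flip x A \<in> F} \<le> 2 * d"
      by blast
    have "\<exists>g. \<forall>C\<in>F - {A}. card {x \<in> X. g (C - {x}) x \<noteq> (x \<in> C)} \<le> 2 * d"
    proof (rule remove.IH[OF A(1)])
      show "F - {A} \<subseteq> Pow X"
        using remove.prems(1) by auto
      show "card W \<le> d" if "shatters (F - {A}) W" for W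
        using that by (intro remove.prems(2)) (rule shatters_mono, auto)
    qed
    then obtain g where
      g: "\<forall>C\<in>F - {A}. card {x \<in> X. g (C - {x}) x \<noteq> (x \<in> C)} \<le> 2 * d" ..
    \<comment> \<open>\<open>g'\<close> departs from \<open>g\<close> only on the traces of
      \<open>A\<close>: it sides with the neighbour of \<open>A\<close> if that lies in
      \<open>F\<close>, and with \<open>A\<close> otherwise. Hence \<open>A\<close> errs exactly at
      its edges.\<close>
    define g' where "g' V x =
      (if V = A - {x} then (if ?flip x A \<in> F then x \<notin> A else x \<in> A) else g V x)" for V x
    have "card {x \<in> X. g' (C - {x}) x \<noteq> (x \<in> C)} \<le> 2 * d" if "C \<in> F" for C
    proof (cases "C = A")
      case True
      have "{x \<in> X. g' (C - {x}) x \<noteq> (x \<in> C)} = {x \<in> X. ?flip x A \<in> F}"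
        using True by (auto simp: g'_def)
      then show ?thesis
        using A by simp
    next
      case False
      \<comment> \<open>For another \<open>C\<close> the new rule is consulted only where
        \<open>C\<close> is the neighbour of \<open>A\<close>, and there it is right about
        \<open>C\<close>.\<close>
      have "{x \<in> X. g' (C - {x}) x \<noteq> (x \<in> C)} \<subseteq> {x \<in> X. g (C - {x}) x \<noteq> (x \<in> C)}"
      proof clarify
        fix x assume x: "g' (C - {x}) x \<noteq> (x \<in> C)" "g (C - {x}) x = (x \<in> C)"
        then have eq: "C - {x} = A - {x}"
          by (auto simp: g'_def split: if_splits)
        then have "C = ?flip x A" "(x \<in> C) = (x \<notin> A)"
          using False by auto
        then show False
          using x that eq by (auto simp: g'_def split: if_splits)
      qed
      then have "card {x \<in> X. g' (C - {x}) x \<noteq> (x \<in> C)} \<le> card {x \<in> X. g (C - {x}) x \<noteq> (x \<in> C)}"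
        using assms(1) by (intro card_mono) auto
      then show ?thesis
        using bspec[OF g, of C] that False by simp
    qed
    then show ?case
      by blast
  qed
qed

section \<open>Leave-one-out prediction at one threshold and of real values\<close>

lemma sum_of_bool_eq_card:
  "finite A \<Longrightarrow> (\<Sum>x\<in>A. of_bool (P x)) = real (card {x \<in> A. P x})"
  by (simp add: Collect_conj_eq)

text \<open>A set shattered by the traces of functions without stars, listed without repetition, is
  fatly V-shattered with the same \<open>r\<close>, so the one-inclusion predictor applies with
  dimension \<open>d\<close>. Nothing is charged at points where \<open>u\<close> is within
  \<open>\<gamma>\<close> of \<open>r\<close>.\<close>

lemma threshold_predictor:
  assumes "finite I" "r \<in> {0..1}" "0 < \<gamma>"
    and dim: "\<And>xs. set xs \<subseteq> I \<Longrightarrow> fatly_V_shattered G \<gamma> xs \<Longrightarrow> length xs \<le> d"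
  shows "\<exists>P. (\<forall>t u v. (\<forall>i\<in>I - {t}. u i = v i) \<longrightarrow> P t u = P t v) \<and>
    (\<forall>u\<in>G. card {t \<in> I. (u t \<ge> r + \<gamma> \<and> \<not> P t u) \<or> (u t \<le> r - \<gamma> \<and> P t u)} \<le> 2 * d)"
proof -
  \<comment> \<open>Stars sit at different points for different functions, so each candidate set
    \<open>Y\<close> of star-free points gets its own family and its own predictor.\<close>
  define F where "F Y = {{i \<in> Y. psi r \<gamma> (u i) = One} | u. u \<in> G \<and> (\<forall>i\<in>Y. psi r \<gamma> (u i) \<noteq> Star)}"
    for Y
  have "\<exists>g. \<forall>A\<in>F Y. card {x \<in> Y. g (A - {x}) x \<noteq> (x \<in> A)} \<le> 2 * d" if "Y \<subseteq> I" for Y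
  proof (rule one_inclusion_predictor)
    show "finite Y"
      using that assms(1) finite_subset by blast
    show "F Y \<subseteq> Pow Y"
      by (auto simp: F_def)
    fix W assume W: "shatters (F Y) W"
    have "W \<in> (\<lambda>A. A \<inter> W) ` F Y"
      using W by (auto simp: shatters_def)
    then have "W \<subseteq> Y"
      by (auto simp: F_def)
    then have "finite W"
      using \<open>finite Y\<close> finite_subset by blast
    then obtain xs where xs: "set xs = W" "distinct xs"
      using finite_distinct_list by blast
    have "fatly_V_shattered G \<gamma> xs"
      unfolding fatly_V_shattered_def
    proof (intro bexI[OF _ assms(2)] subsetI)
      fix p assume "p \<in> {p. length p = length xs \<and> set p \<subseteq> {Zero, One}}"
      then have p: "length p = length xs" "set p \<subseteq> {Zero, One}"
        by auto
      have "{xs ! k | k. k < length xs \<and> p ! k = One} \<in> Pow W"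
        using xs(1) by auto
      then have "{xs ! k | k. k < length xs \<and> p ! k = One} \<in> (\<lambda>A. A \<inter> W) ` F Y"
        using W unfolding shatters_def by (rule subsetD[rotated])
      then obtain A where A: "{xs ! k | k. k < length xs \<and> p ! k = One} = A \<inter> W" "A \<in> F Y"
        by (rule imageE)
      from A(2) obtain u where u: "u \<in> G" "\<forall>i\<in>Y. psi r \<gamma> (u i) \<noteq> Star"
        "A = {i \<in> Y. psi r \<gamma> (u i) = One}"
        unfolding F_def by blast
      have "p = map (\<lambda>x. psi r \<gamma> (u x)) xs"
      proof (rule nth_equalityI)
        fix k assume k: "k < length p"
        have mem: "xs ! k \<in> W" "xs ! k \<in> Y"
          using k p(1) xs(1) \<open>W \<subseteq> Y\<close> by auto
        have "(p ! k = One) = (xs ! k \<in> {xs ! k | k. k < length xs \<and> p ! k = One})"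
          using k p(1) xs(2) by (auto simp: nth_eq_iff_index_eq)
        also have "\<dots> = (psi r \<gamma> (u (xs ! k)) = One)"
          unfolding A(1) u(3) using mem by simp
        finally have one: "(p ! k = One) = (psi r \<gamma> (u (xs ! k)) = One)" .
        have "p ! k \<in> {Zero, One}"
          using k p(2) nth_mem by blast
        moreover have "psi r \<gamma> (u (xs ! k)) \<noteq> Star"
          using u(2) mem by blast
        ultimately have "p ! k = psi r \<gamma> (u (xs ! k))"
          using one by (cases "psi r \<gamma> (u (xs ! k))") auto
        then show "p ! k = map (\<lambda>x. psi r \<gamma> (u x)) xs ! k"
          using k p(1) by simp
      qed (use p in simp)
      then show "p \<in> {map (\<lambda>x. psi r \<gamma> (f x)) xs | f. f \<in> G}"
        using u(1) by blast
    qed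
    then have "length xs \<le> d"
      using dim xs(1) \<open>W \<subseteq> Y\<close> that by blast
    then show "card W \<le> d"
      using xs distinct_card by metis
  qed
  then have "\<forall>Y. \<exists>g. Y \<subseteq> I \<longrightarrow> (\<forall>A\<in>F Y. card {x \<in> Y. g (A - {x}) x \<noteq> (x \<in> A)} \<le> 2 * d)"
    by simp
  from choice[OF this] obtain g where
    g: "\<And>Y A. Y \<subseteq> I \<Longrightarrow> A \<in> F Y \<Longrightarrow> card {x \<in> Y. g Y (A - {x}) x \<noteq> (x \<in> A)} \<le> 2 * d"
    by blast
  \<comment> \<open>Since \<open>u t\<close> is hidden, \<open>t\<close> is always treated as
    star-free. This guess is right whenever an error at \<open>t\<close> is charged.\<close>
  define P where "P t u = g {i \<in> I. i = t \<or> psi r \<gamma> (u i) \<noteq> Star} {i \<in> I - {t}. psi r \<gamma> (u i) = One} t"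
    for t u
  show ?thesis
  proof (intro exI[of _ P] conjI allI impI ballI)
    fix t :: 'a and u v :: "'a \<Rightarrow> real"
    assume eq: "\<forall>i\<in>I - {t}. u i = v i"
    then have "{i \<in> I. i = t \<or> psi r \<gamma> (u i) \<noteq> Star} = {i \<in> I. i = t \<or> psi r \<gamma> (v i) \<noteq> Star}"
      "{i \<in> I - {t}. psi r \<gamma> (u i) = One} = {i \<in> I - {t}. psi r \<gamma> (v i) = One}"
      by auto
    then show "P t u = P t v"
      by (simp add: P_def)
  next
    fix u assume "u \<in> G"
    define Y where "Y = {i \<in> I. psi r \<gamma> (u i) \<noteq> Star}"
    define A where "A = {i \<in> Y. psi r \<gamma> (u i) = One}"
    have "{t \<in> I. (u t \<ge> r + \<gamma> \<and> \<not> P t u) \<or> (u t \<le> r - \<gamma> \<and> P t u)}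
      \<subseteq> {x \<in> Y. g Y (A - {x}) x \<noteq> (x \<in> A)}"
    proof
      fix t assume t: "t \<in> {t \<in> I. (u t \<ge> r + \<gamma> \<and> \<not> P t u) \<or> (u t \<le> r - \<gamma> \<and> P t u)}"
      then have psi_t: "psi r \<gamma> (u t) = (if P t u then Zero else One)"
        using assms(3) by (auto simp: psi_def)
      then have "t \<in> Y"
        using t by (auto simp: Y_def)
      then have "{i \<in> I. i = t \<or> psi r \<gamma> (u i) \<noteq> Star} = Y"
        "{i \<in> I - {t}. psi r \<gamma> (u i) = One} = A - {t}"
        by (auto simp: Y_def A_def)
      then have "P t u = g Y (A - {t}) t"
        by (simp add: P_def)
      moreover have "t \<in> A \<longleftrightarrow> \<not> P t u"
        using psi_t \<open>t \<in> Y\<close> by (auto simp: A_def)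
      ultimately show "t \<in> {x \<in> Y. g Y (A - {x}) x \<noteq> (x \<in> A)}"
        using \<open>t \<in> Y\<close> by simp
    qed
    moreover have "finite Y"
      using assms(1) by (simp add: Y_def)
    ultimately have "card {t \<in> I. (u t \<ge> r + \<gamma> \<and> \<not> P t u) \<or> (u t \<le> r - \<gamma> \<and> P t u)}
      \<le> card {x \<in> Y. g Y (A - {x}) x \<noteq> (x \<in> A)}"
      by (intro card_mono) auto
    also have "\<dots> \<le> 2 * d"
      using \<open>u \<in> G\<close> by (intro g) (auto simp: Y_def A_def F_def)
    finally show "card {t \<in> I. (u t \<ge> r + \<gamma> \<and> \<not> P t u) \<or> (u t \<le> r - \<gamma> \<and> P t u)} \<le> 2 * d" .
  qed
qed

text \<open>Averaging the threshold predictions over \<open>r = j / N\<close> recovers the value up to \<open>\<gamma> + 1 / N\<close>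
  plus the fraction of mistaken thresholds; this costs only \<open>\<gamma>\<close>, not the full width \<open>2 \<gamma>\<close>
  of the undecided window.\<close>

lemma threshold_average_error:
  fixes p :: "nat \<Rightarrow> bool" and u \<gamma> :: real
  assumes "N > 0" "u \<in> {0..1}" "0 < \<gamma>"
  defines "wrong j \<equiv> (u \<ge> real j / real N + \<gamma> \<and> \<not> p j) \<or> (u \<le> real j / real N - \<gamma> \<and> p j)"
  shows "\<bar>(\<Sum>j=1..N. of_bool (p j)) / real N - u\<bar>
    \<le> \<gamma> + 1 / real N + (\<Sum>j=1..N. of_bool (wrong j)) / real N"
proof -
  have N: "real N > 0"
    using assms(1) by simp
  define s where "s = (\<Sum>j=1..N. of_bool (p j) :: real)"
  define w where "w = (\<Sum>j=1..N. of_bool (wrong j) :: real)"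
  \<comment> \<open>A true \<open>p j\<close> is wrong for \<open>j \<ge> c\<close> and a false one
    is wrong for \<open>j \<le> c'\<close>. This confines \<open>s\<close> to the range from
    \<open>c'\<close> to \<open>c\<close>, up to \<open>w\<close> and rounding.\<close>
  define c where "c = real N * (u + \<gamma>)"
  define c' where "c' = real N * (u - \<gamma>)"
  have c: "u \<le> real j / real N - \<gamma> \<longleftrightarrow> c \<le> real j" for j
    using N by (simp add: c_def field_simps)
  have c': "u \<ge> real j / real N + \<gamma> \<longleftrightarrow> real j \<le> c'" for j
    using N by (simp add: c'_def field_simps)
  have "c \<ge> 0"
    using assms by (simp add: c_def)
  have "c' \<le> real N"
    using assms by (simp add: c'_def mult_left_le)
  have sum_card: "(\<Sum>j=1..N. of_bool (q j)) = real (card {j \<in> {1..N}. q j})" for q :: "nat \<Rightarrow> bool"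
    by (rule sum_of_bool_eq_card) simp
  have "s \<le> (\<Sum>j=1..N. of_bool (real j < c) + of_bool (wrong j))"
    unfolding s_def by (rule sum_mono) (auto simp: wrong_def c)
  also have "\<dots> = real (card {j \<in> {1..N}. real j < c}) + w"
    by (simp only: sum.distrib w_def sum_card)
  also have "card {j \<in> {1..N}. real j < c} \<le> card {1..nat \<lfloor>c\<rfloor>}"
    by (rule card_mono) (auto simp: le_nat_floor)
  also have "real (card {1..nat \<lfloor>c\<rfloor>}) \<le> c"
    using \<open>c \<ge> 0\<close> by simp
  finally have upper: "s \<le> c + w"
    by simp
  \<comment> \<open>Rounding \<open>c'\<close> down loses at most one index, whence the term
    \<open>1 / N\<close>; for negative \<open>c'\<close> the interval is empty and the bound
    trivial.\<close>
  have "c' - 1 \<le> real (card {1..nat \<lfloor>c'\<rfloor>})"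
    by simp linarith
  also have "card {1..nat \<lfloor>c'\<rfloor>} \<le> card {j \<in> {1..N}. real j \<le> c'}"
  proof (intro card_mono subsetI)
    fix j assume j: "j \<in> {1..nat \<lfloor>c'\<rfloor>}"
    then have "int j \<le> \<lfloor>c'\<rfloor>"
      by auto
    then have "real j \<le> c'"
      by (simp add: le_floor_iff)
    then show "j \<in> {j \<in> {1..N}. real j \<le> c'}"
      using j \<open>c' \<le> real N\<close> by auto
  qed simp
  also have "real (card {j \<in> {1..N}. real j \<le> c'}) = (\<Sum>j=1..N. of_bool (real j \<le> c'))"
    by (rule sum_card[symmetric])
  also have "\<dots> \<le> (\<Sum>j=1..N. of_bool (p j) + of_bool (wrong j))"
    by (rule sum_mono) (auto simp: wrong_def c')
  also have "\<dots> = s + w"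
    by (simp only: sum.distrib s_def w_def)
  finally have lower: "c' - 1 \<le> s + w"
    by simp
  have "\<bar>s - real N * u\<bar> \<le> real N * \<gamma> + 1 + w"
    using upper lower by (simp add: c_def c'_def algebra_simps abs_le_iff)
  then have "\<bar>s - real N * u\<bar> / real N \<le> (real N * \<gamma> + 1 + w) / real N"
    by (rule divide_right_mono) simp
  moreover have "s - real N * u = real N * (s / real N - u)"
    using N by (simp add: field_simps)
  ultimately show ?thesis
    using N unfolding s_def[symmetric] w_def[symmetric]
    by (simp add: abs_mult add_divide_distrib)
qed

text \<open>Each prediction averages \<open>N\<close> threshold predictions. After swapping sums,
  every threshold contributes at most \<open>2 * d\<close> wrong points, so the wrong fractions
  total at most \<open>2 * d\<close> over all of \<open>I\<close>, whatever its size.\<close>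

lemma real_predictor:
  assumes "finite I" "0 < \<gamma>" "N > 0"
    and dim: "\<And>xs. set xs \<subseteq> I \<Longrightarrow> fatly_V_shattered G \<gamma> xs \<Longrightarrow> length xs \<le> d"
    and range: "\<And>u i. u \<in> G \<Longrightarrow> i \<in> I \<Longrightarrow> u i \<in> {0..1}"
  shows "\<exists>H. (\<forall>t u v. (\<forall>i\<in>I - {t}. u i = v i) \<longrightarrow> H t u = H t v) \<and>
    (\<forall>u\<in>G. (\<Sum>t\<in>I. \<bar>H t u - u t\<bar>) \<le> real (card I) * (\<gamma> + 1 / real N) + 2 * real d)"
proof -
  let ?wrong = "\<lambda>P j t u. (u t \<ge> real j / real N + \<gamma> \<and> \<not> P j t u) \<or> (u t \<le> real j / real N - \<gamma> \<and> P j t u)"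
  have "\<forall>j\<in>{1..N}. \<exists>P. (\<forall>t u v. (\<forall>i\<in>I - {t}. u i = v i) \<longrightarrow> P t u = P t v) \<and>
      (\<forall>u\<in>G. card {t \<in> I. ?wrong (\<lambda>_. P) j t u} \<le> 2 * d)"
    by (intro ballI threshold_predictor[OF assms(1) _ assms(2)] dim) (auto simp: divide_le_eq_1)
  then have "\<exists>P. \<forall>j\<in>{1..N}. (\<forall>t u v. (\<forall>i\<in>I - {t}. u i = v i) \<longrightarrow> P j t u = P j t v) \<and>
      (\<forall>u\<in>G. card {t \<in> I. ?wrong P j t u} \<le> 2 * d)"
    by (rule bchoice)
  then obtain P where
    P: "\<forall>j\<in>{1..N}. (\<forall>t u v. (\<forall>i\<in>I - {t}. u i = v i) \<longrightarrow> P j t u = P j t v) \<and>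
      (\<forall>u\<in>G. card {t \<in> I. ?wrong P j t u} \<le> 2 * d)" ..
  define H where "H t u = (\<Sum>j=1..N. of_bool (P j t u)) / real N" for t u
  show ?thesis
  proof (intro exI[of _ H] conjI allI impI ballI)
    fix t :: 'a and u v :: "'a \<Rightarrow> real"
    assume eq: "\<forall>i\<in>I - {t}. u i = v i"
    have "P j t u = P j t v" if "j \<in> {1..N}" for j
      using bspec[OF P that, THEN conjunct1, THEN spec, THEN spec, THEN spec, THEN mp, OF eq] .
    then show "H t u = H t v"
      by (simp add: H_def del: sum_of_bool_eq)
  next
    fix u assume u: "u \<in> G"
    have "(\<Sum>t\<in>I. \<bar>H t u - u t\<bar>)
        \<le> (\<Sum>t\<in>I. \<gamma> + 1 / real N + (\<Sum>j=1..N. of_bool (?wrong P j t u)) / real N)"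
      unfolding H_def
      by (intro sum_mono threshold_average_error[OF assms(3) _ assms(2)] range u)
    also have "\<dots> = real (card I) * (\<gamma> + 1 / real N) +
        (\<Sum>t\<in>I. \<Sum>j=1..N. of_bool (?wrong P j t u)) / real N"
      by (simp only: sum.distrib sum_divide_distrib sum_constant distrib_left)
    also have "(\<Sum>t\<in>I. \<Sum>j=1..N. of_bool (?wrong P j t u)) =
        (\<Sum>j=1..N. \<Sum>t\<in>I. of_bool (?wrong P j t u) :: real)"
      by (rule sum.swap)
    also have "\<dots> = (\<Sum>j=1..N. real (card {t \<in> I. ?wrong P j t u}))"
      by (intro sum.cong refl sum_of_bool_eq_card assms(1))
    also have "\<dots> \<le> (\<Sum>j=1..N. 2 * real d)"
    proof (rule sum_mono)
      fix j assume "j \<in> {1..N}"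
      from bspec[OF bspec[OF P this, THEN conjunct2] u] show "real (card {t \<in> I. ?wrong P j t u}) \<le> 2 * real d"
        by linarith
    qed
    finally show "(\<Sum>t\<in>I. \<bar>H t u - u t\<bar>) \<le> real (card I) * (\<gamma> + 1 / real N) + 2 * real d"
      using assms(3) by (simp add: divide_right_mono)
  qed
qed

section \<open>Averaging over samples and counting a separated set\<close>

text \<open>Resampling one coordinate of a uniform sample leaves it uniform:
  \<open>(x, y) \<mapsto> (x(t := y), x t)\<close> is an involution.\<close>

lemma sum_PiE_fun_upd:
  fixes g :: "('i \<Rightarrow> 'a) \<Rightarrow> real"
  assumes "t \<in> I"
  shows "(\<Sum>x\<in>I \<rightarrow>\<^sub>E A. \<Sum>y\<in>A. g (x(t := y))) = real (card A) * (\<Sum>x\<in>I \<rightarrow>\<^sub>E A. g x)"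
proof -
  have "(\<Sum>x\<in>I \<rightarrow>\<^sub>E A. \<Sum>y\<in>A. g (x(t := y))) = (\<Sum>(x, y)\<in>(I \<rightarrow>\<^sub>E A) \<times> A. g (x(t := y)))"
    by (rule sum.cartesian_product)
  also have "\<dots> = (\<Sum>(x, y)\<in>(I \<rightarrow>\<^sub>E A) \<times> A. g x)"
    by (rule sum.reindex_bij_witness[where i = "\<lambda>(x, y). (x(t := y), x t)"
          and j = "\<lambda>(x, y). (x(t := y), x t)"])
       (use assms in \<open>auto simp: PiE_iff extensional_def\<close>)
  also have "\<dots> = (\<Sum>x\<in>I \<rightarrow>\<^sub>E A. \<Sum>y\<in>A. g x)"
    by (rule sum.cartesian_product[symmetric])
  finally show ?thesis
    by (simp add: sum_distrib_left)
qed

text \<open>The pattern of \<open>f \<circ> x\<close> along \<open>xs\<close> is the pattern of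
  \<open>f\<close> along \<open>map x xs\<close>. Thus passing to the positions of a sample does not
  raise the dimension, even if the sample repeats points.\<close>

lemma fatly_V_shattered_comp:
  assumes "fatly_V_shattered ((\<lambda>f. f \<circ> x) ` S) \<gamma> xs"
  shows "fatly_V_shattered S \<gamma> (map x xs)"
  using assms unfolding fatly_V_shattered_def by (fastforce simp: comp_def)

text \<open>The bracket is the gap between \<open>\<epsilon> / 2\<close>, the error up to which
  labels determine an element of \<open>T\<close>, and the average prediction error. The bound is
  informative only when this gap is positive.\<close>

lemma packing_card_bound:
  fixes S :: "(nat \<Rightarrow> real) set" and \<gamma> \<epsilon> :: real
  assumes "finite B" "B \<subseteq> {0..1}" "S \<subseteq> {1..m} \<rightarrow>\<^sub>E B" "m > 0" "0 < \<gamma>" "N > 0"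
    and dim: "\<And>xs. set xs \<subseteq> {1..m} \<Longrightarrow> fatly_V_shattered S \<gamma> xs \<Longrightarrow> length xs \<le> d"
    and T: "T \<subseteq> S" "finite T" "\<And>v w. v \<in> T \<Longrightarrow> w \<in> T \<Longrightarrow> v \<noteq> w \<Longrightarrow> l1_dist m v w > \<epsilon>"
    and "0 < \<epsilon>"
  shows "real (card T) * (\<epsilon> / 2 - \<gamma> - 1 / real N - 2 * real d / real (n + 1)) \<le> real (card B) ^ n * (\<epsilon> / 2)"
proof -
  define I where "I = {..n}"
  define A where "A = {1..m}"
  define Q where "Q = I \<rightarrow>\<^sub>E A"
  define K where "K = real (n + 1) * (\<gamma> + 1 / real N) + 2 * real d"
  have I: "finite I" "card I = n + 1"
    by (auto simp: I_def)
  have A: "finite A" "card A = m" "A \<noteq> {}"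
    using assms(4) by (auto simp: A_def)
  have Q: "finite Q" "Q \<noteq> {}"
    using A I by (auto simp: Q_def intro!: finite_PiE) (simp add: PiE_eq_empty_iff)
  have range: "f y \<in> B" if "f \<in> S" "y \<in> A" for f y
    using that assms(3) unfolding A_def by (meson PiE_mem subsetD)

  have "\<forall>x\<in>Q. \<exists>H. (\<forall>t u v. (\<forall>i\<in>I - {t}. u i = v i) \<longrightarrow> H t u = H t v) \<and>
    (\<forall>u\<in>(\<lambda>f. f \<circ> x) ` S. (\<Sum>t\<in>I. \<bar>H t u - u t\<bar>) \<le> K)"
    unfolding K_def I(2)[symmetric]
  proof (intro ballI real_predictor[OF I(1) assms(5,6)])
    fix x xs assume "x \<in> Q" and xs: "set xs \<subseteq> I" "fatly_V_shattered ((\<lambda>f. f \<circ> x) ` S) \<gamma> xs"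
    have "set (map x xs) \<subseteq> {1..m}"
      using xs(1) \<open>x \<in> Q\<close> by (auto simp: Q_def A_def dest!: PiE_mem)
    from dim[OF this fatly_V_shattered_comp[OF xs(2)]] show "length xs \<le> d"
      by simp
  next
    fix x u i assume "x \<in> Q" and "u \<in> (\<lambda>f. f \<circ> x) ` S" "i \<in> I"
    then obtain f where "f \<in> S" "u i = f (x i)"
      by auto
    moreover have "x i \<in> A"
      using \<open>x \<in> Q\<close> \<open>i \<in> I\<close> by (auto simp: Q_def)
    ultimately show "u i \<in> {0..1}"
      using range assms(2) by fastforce
  qed
  then have "\<exists>H. \<forall>x\<in>Q. (\<forall>t u v. (\<forall>i\<in>I - {t}. u i = v i) \<longrightarrow> H x t u = H x t v) \<and>
    (\<forall>u\<in>(\<lambda>f. f \<circ> x) ` S. (\<Sum>t\<in>I. \<bar>H x t u - u t\<bar>) \<le> K)"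
    by (rule bchoice)
  then obtain H where
    H: "\<forall>x\<in>Q. (\<forall>t u v. (\<forall>i\<in>I - {t}. u i = v i) \<longrightarrow> H x t u = H x t v) \<and>
      (\<forall>u\<in>(\<lambda>f. f \<circ> x) ` S. (\<Sum>t\<in>I. \<bar>H x t u - u t\<bar>) \<le> K)" ..
  have H_cong: "H x t u = H x t v" if "x \<in> Q" "\<forall>i\<in>I - {t}. u i = v i" for x t u v
    using bspec[OF H that(1), THEN conjunct1, THEN spec, THEN spec, THEN spec, THEN mp, OF that(2)] .
  have H_err: "(\<Sum>t\<in>I. \<bar>H x t (f \<circ> x) - f (x t)\<bar>) \<le> K" if "x \<in> Q" "f \<in> S" for x f
    using bspec[OF bspec[OF H that(1), THEN conjunct2] imageI[OF that(2)]] by simp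
  define err where "err f t x = \<bar>H x t (f \<circ> x) - f (x t)\<bar>" for f t x

  \<comment> \<open>Averaging over all pairs of a sample and a test position: resampling position
    \<open>t\<close> gives \<open>m\<close> times the leave-one-out error, and \<open>H_err\<close>
    bounds the sum of that error over the \<open>n + 1\<close> positions by
    \<open>K\<close>.\<close>
  have "\<exists>x\<in>Q. \<exists>t\<in>I. (\<Sum>y\<in>A. \<Sum>f\<in>T. err f t (x(t := y))) \<le> real m * real (card T) * K / real (n + 1)"
  proof (rule ccontr)
    assume "\<not> ?thesis"
    then have "(\<Sum>x\<in>Q. \<Sum>t\<in>I. real m * real (card T) * K / real (n + 1))
        < (\<Sum>x\<in>Q. \<Sum>t\<in>I. \<Sum>y\<in>A. \<Sum>f\<in>T. err f t (x(t := y)))"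
      using Q I by (intro sum_strict_mono) (auto simp: not_le)
    also have "\<dots> = (\<Sum>t\<in>I. \<Sum>x\<in>Q. \<Sum>y\<in>A. \<Sum>f\<in>T. err f t (x(t := y)))"
      by (rule sum.swap)
    also have "\<dots> = (\<Sum>t\<in>I. real m * (\<Sum>x\<in>Q. \<Sum>f\<in>T. err f t x))"
      unfolding Q_def A(2)[symmetric] by (intro sum.cong refl sum_PiE_fun_upd)
    also have "\<dots> = real m * (\<Sum>t\<in>I. \<Sum>x\<in>Q. \<Sum>f\<in>T. err f t x)"
      by (simp add: sum_distrib_left)
    also have "(\<Sum>t\<in>I. \<Sum>x\<in>Q. \<Sum>f\<in>T. err f t x) = (\<Sum>x\<in>Q. \<Sum>t\<in>I. \<Sum>f\<in>T. err f t x)"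
      by (rule sum.swap)
    also have "\<dots> = (\<Sum>x\<in>Q. \<Sum>f\<in>T. \<Sum>t\<in>I. err f t x)"
      by (intro sum.cong refl sum.swap)
    also have "\<dots> \<le> (\<Sum>x\<in>Q. \<Sum>f\<in>T. K)"
      unfolding err_def using T(1) by (intro sum_mono H_err) auto
    finally show False
      using assms(4) by (simp add: I(2) mult_left_mono mult_ac)
  qed
  then obtain x t where x: "x \<in> Q" and t: "t \<in> I" and
    le: "(\<Sum>y\<in>A. \<Sum>f\<in>T. err f t (x(t := y))) \<le> real m * real (card T) * K / real (n + 1)"
    by blast
  have upd: "x(t := y) \<in> Q" if "y \<in> A" for y
    using x t that by (auto simp: Q_def PiE_iff extensional_def)
  \<comment> \<open>\<open>e f\<close> is \<open>m\<close> times the normalized distance from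
    \<open>f\<close> to its prediction at all points \<open>y\<close>, hence the threshold
    \<open>m * (\<epsilon> / 2)\<close> in \<open>good\<close>.\<close>
  define e where "e f = (\<Sum>y\<in>A. err f t (x(t := y)))" for f
  define good where "good = {f \<in> T. e f \<le> real m * (\<epsilon> / 2)}"
  have good: "good \<subseteq> T" "finite good"
    using T(2) by (auto simp: good_def)
  have "card good \<le> card ((I - {t}) \<rightarrow>\<^sub>E B)"
  proof (rule card_inj_on_le)
    show "finite ((I - {t}) \<rightarrow>\<^sub>E B)"
      using I assms(1) by (intro finite_PiE) auto
    show "(\<lambda>f. restrict (f \<circ> x) (I - {t})) ` good \<subseteq> (I - {t}) \<rightarrow>\<^sub>E B"
    proof (intro image_subsetI, subst restrict_PiE_iff, intro ballI)
      fix f i assume "f \<in> good" "i \<in> I - {t}"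
      then have "f \<in> S" "x i \<in> A"
        using x good(1) T(1) by (auto simp: Q_def)
      then show "(f \<circ> x) i \<in> B"
        by (simp add: range)
    qed
    show "inj_on (\<lambda>f. restrict (f \<circ> x) (I - {t})) good"
    proof (rule inj_onI, rule ccontr)
      fix f g assume fg: "f \<in> good" "g \<in> good" "f \<noteq> g"
        and eq: "restrict (f \<circ> x) (I - {t}) = restrict (g \<circ> x) (I - {t})"
      have "f (x i) = g (x i)" if "i \<in> I - {t}" for i
        using fun_cong[OF eq, of i] that by simp
      \<comment> \<open>The prediction at \<open>y\<close> ignores position \<open>t\<close>, the
        only one where the labels of \<open>f\<close> and \<open>g\<close> can differ.\<close>
      then have H_eq: "H (x(t := y)) t (f \<circ> x(t := y)) = H (x(t := y)) t (g \<circ> x(t := y))" if "y \<in> A" for y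
        using upd[OF that] by (intro H_cong) auto
      \<comment> \<open>Triangle inequality through the common prediction.\<close>
      have "(\<Sum>y\<in>A. \<bar>f y - g y\<bar>) \<le> (\<Sum>y\<in>A. err f t (x(t := y)) + err g t (x(t := y)))"
      proof (rule sum_mono)
        fix y assume "y \<in> A"
        from H_eq[OF this] show "\<bar>f y - g y\<bar> \<le> err f t (x(t := y)) + err g t (x(t := y))"
          by (simp add: err_def)
      qed
      also have "\<dots> = e f + e g"
        by (simp add: e_def sum.distrib)
      also have "\<dots> \<le> real m * \<epsilon>"
        using fg by (simp add: good_def)
      finally have "l1_dist m f g \<le> \<epsilon>"
        using assms(4) by (simp add: l1_dist_def A_def field_simps)
      moreover have "l1_dist m f g > \<epsilon>"
        using fg good(1) by (intro T(3)) auto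
      ultimately show False
        by simp
    qed
  qed
  also have "card ((I - {t}) \<rightarrow>\<^sub>E B) = card B ^ n"
    using I t by (simp add: card_PiE)
  finally have card_good: "real (card good) \<le> real (card B) ^ n"
    by (metis of_nat_le_iff of_nat_power)

  \<comment> \<open>Markov's inequality: each element outside \<open>good\<close> contributes more
    than \<open>m * (\<epsilon> / 2)\<close> to the total error.\<close>
  have "(real (card T) - real (card good)) * (real m * (\<epsilon> / 2)) = (\<Sum>f\<in>T - good. real m * (\<epsilon> / 2))"
    using good T(2) by (simp add: card_Diff_subset card_mono of_nat_diff)
  also have "\<dots> \<le> (\<Sum>f\<in>T - good. e f)"
    by (rule sum_mono) (auto simp: good_def)
  also have "\<dots> \<le> (\<Sum>f\<in>T. e f)"
    using T(2) by (intro sum_mono2) (auto simp: e_def err_def sum_nonneg)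
  also have "\<dots> = (\<Sum>y\<in>A. \<Sum>f\<in>T. err f t (x(t := y)))"
    unfolding e_def by (rule sum.swap)
  also have "\<dots> \<le> real m * (real (card T) * (K / real (n + 1)))"
    using le by simp
  finally have "(real (card T) - real (card good)) * (\<epsilon> / 2) \<le> real (card T) * (K / real (n + 1))"
    using assms(4) by (simp add: mult.left_commute[of _ "real m"] del: times_divide_eq_right)
  moreover have "real (card good) * (\<epsilon> / 2) \<le> real (card B) ^ n * (\<epsilon> / 2)"
    using card_good \<open>0 < \<epsilon>\<close> by (intro mult_right_mono) auto
  ultimately have "real (card T) * (\<epsilon> / 2 - K / real (n + 1)) \<le> real (card B) ^ n * (\<epsilon> / 2)"
    unfolding left_diff_distrib right_diff_distrib by linarith
  moreover have "\<epsilon> / 2 - K / real (n + 1) = \<epsilon> / 2 - \<gamma> - 1 / real N - 2 * real d / real (n + 1)"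
    by (simp add: K_def add_divide_distrib)
  ultimately show ?thesis
    by (simp only:)
qed

section \<open>Choice of the constants\<close>

theorem lemma10:
  fixes \<epsilon> \<alpha> :: real and b m d :: nat and B :: "real set" and S :: "(nat \<Rightarrow> real) set"
  assumes "0 < \<epsilon>" and "\<epsilon> < 1"
    and "b > 0"
    and "0 < \<alpha>" and "\<alpha> < \<epsilon> / 4"
    and "B = {real i / real b | i. i \<le> b}"
    and "m > 0"
    and "S \<subseteq> ({1..m} \<rightarrow>\<^sub>E B)"
    and "fatV {1..m} S (\<epsilon> / 2 - \<alpha>) = enat d"
    and "d \<ge> 1"
  shows "ereal_of_enat (packing_number m \<epsilon> S)
           \<le> ereal (\<epsilon> / (2 * \<alpha>) * (real b + 1) powr (4 * real d / \<alpha>))"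
proof -
  define R where "R = \<epsilon> / (2 * \<alpha>) * (real b + 1) powr (4 * real d / \<alpha>)"
  define D where "D = 4 * real d / \<alpha>"
  \<comment> \<open>The two powers of \<open>b + 1\<close> held back here absorb a factor 4 at the
    end.\<close>
  define n where "n = nat \<lfloor>D\<rfloor> - 2"
  \<comment> \<open>\<open>\<alpha> < 1 / 4\<close> and \<open>d \<ge> 1\<close> make
    \<open>D\<close> at least 16, so the truncated subtraction in \<open>n\<close> is exact and
    \<open>n + 1\<close> is at least \<open>7 / 8\<close> of \<open>D\<close>.\<close>
  have "16 * \<alpha> \<le> 4 * real d"
    using assms(2,5,10) by linarith
  then have D: "D \<ge> 16"
    using assms(4) by (simp add: D_def field_simps)
  have n: "real n + 2 \<le> D" "D < real n + 3"
  proof -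
    have "16 \<le> \<lfloor>D\<rfloor>"
      using D by (simp add: le_floor_iff)
    then have "real n = of_int \<lfloor>D\<rfloor> - 2"
      unfolding n_def by linarith
    then show "real n + 2 \<le> D" "D < real n + 3"
      by linarith+
  qed
  have B_image: "B = (\<lambda>i. real i / real b) ` {..b}"
    using assms(6) by auto
  have B: "finite B" "B \<subseteq> {0..1}"
    by (auto simp: B_image divide_le_eq_1)
  have "card B \<le> b + 1"
    unfolding B_image using card_image_le[of "{..b}" "\<lambda>i. real i / real b"] by simp
  have dim: "length xs \<le> d" if "set xs \<subseteq> {1..m}" "fatly_V_shattered S (\<epsilon> / 2 - \<alpha>) xs" for xs
  proof -
    have "enat (length xs) \<le> fatV {1..m} S (\<epsilon> / 2 - \<alpha>)"
      unfolding fatV_def using that by (intro SUP_upper) auto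
    then show ?thesis
      using assms(9) by simp
  qed
  have bound: "real (card T) \<le> R"
    if T: "T \<subseteq> S" "finite T" "\<forall>v\<in>T. \<forall>w\<in>T. v \<noteq> w \<longrightarrow> l1_dist m v w > \<epsilon>" for T
  proof -
    \<comment> \<open>\<open>\<delta>\<close> is the loss beyond \<open>\<gamma>\<close> for
      \<open>N = 2 * (n + 1)\<close>. It uses up at most three quarters of \<open>\<alpha>\<close>;
      the remaining \<open>\<alpha> / 4\<close> is the source of the factor 4.\<close>
    define \<delta> where "\<delta> = 1 / real (2 * (n + 1)) + 2 * real d / real (n + 1)"
    have "\<delta> = (1 / 2 + 2 * real d) / real (n + 1)"
      unfolding \<delta>_def of_nat_mult by (simp add: add_divide_distrib)
    also have "\<dots> \<le> (5 / 2 * real d) / real (n + 1)"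
      using assms(10) by (intro divide_right_mono) auto
    also have "\<dots> \<le> 3 / 4 * \<alpha>"
    proof -
      have "10 * real d = 5 / 2 * (D * \<alpha>)"
        using assms(4) by (simp add: D_def)
      also have "D * \<alpha> \<le> (8 / 7 * (real n + 1)) * \<alpha>"
      proof (rule mult_right_mono)
        have "7 * D \<le> 8 * (real n + 1)"
          using n(2) D by simp
        then show "D \<le> 8 / 7 * (real n + 1)"
          by simp
      qed (use assms(4) in simp)
      finally show ?thesis
        using assms(4) by (simp add: field_simps)
    qed
    finally have \<delta>: "\<alpha> / 4 \<le> \<alpha> - \<delta>"
      by simp
    have "real (card T) * (\<alpha> / 4) \<le> real (card T) * (\<alpha> - \<delta>)"
      using \<delta> by (intro mult_left_mono) auto
    also have "\<dots> = real (card T) * (\<epsilon> / 2 - (\<epsilon> / 2 - \<alpha>) - 1 / real (2 * (n + 1)) - 2 * real d / real (n + 1))"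
      by (simp add: \<delta>_def)
    also have "\<dots> \<le> real (card B) ^ n * (\<epsilon> / 2)"
      using T by (intro packing_card_bound[OF B assms(8,7)] dim)
                 (use assms(1,4,5) in auto)
    also have "\<dots> \<le> (real b + 1) ^ n * (\<epsilon> / 2)"
      using \<open>card B \<le> b + 1\<close> assms(1) by (intro mult_right_mono power_mono) auto
    finally have 1: "real (card T) \<le> \<epsilon> / (2 * \<alpha>) * (4 * (real b + 1) ^ n)"
      using assms(4) by (simp add: field_simps)
    have "2\<^sup>2 \<le> (real b + 1)\<^sup>2"
      using assms(3) by (intro power_mono) auto
    then have "4 * (real b + 1) ^ n \<le> (real b + 1)\<^sup>2 * (real b + 1) ^ n"
      by (intro mult_right_mono) auto
    also have "\<dots> = (real b + 1) powr (real n + 2)"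
      by (simp add: powr_add powr_realpow powr_numeral)
    also have "\<dots> \<le> (real b + 1) powr D"
      using n by (intro powr_mono) auto
    finally have "\<epsilon> / (2 * \<alpha>) * (4 * (real b + 1) ^ n) \<le> R"
      unfolding R_def D_def using assms(1,4) by (intro mult_left_mono) auto
    then show ?thesis
      using 1 by simp
  qed
  have "0 \<le> R"
    using bound[of "{}"] by simp
  \<comment> \<open>Cardinalities are integers, so the real bound can be rounded down before taking
    the supremum in \<open>enat\<close>.\<close>
  have "packing_number m \<epsilon> S \<le> enat (nat \<lfloor>R\<rfloor>)"
    unfolding packing_number_def using bound by (intro SUP_least) (auto simp: le_nat_floor)
  then have "ereal_of_enat (packing_number m \<epsilon> S) \<le> ereal_of_enat (enat (nat \<lfloor>R\<rfloor>))"
    by (simp only: ereal_of_enat_le_iff)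
  also have "\<dots> \<le> ereal R"
    using \<open>0 \<le> R\<close> by simp
  finally show ?thesis
    by (simp add: R_def)
qed

end
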